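(* Let $f(x)$ and $g(y)$ be nonconstant polynomials defined over $\mathbb{F}_q$ such that $f(x)-g(y)\notin \mathbb{F}_q[x^p,y^p]$. Suppose that the irreducible components of the curve $\mathcal{F}: f(x)=g(y)$ are defined over $\mathbb{F}_q$ and that $f(x)$ and $g(y)$ are minimal value set polynomials over $\mathbb{F}_q$ with $V_f=V_g=\{0\}$. Then the irreducible components of $\mathcal{F}$ are $q$-Frobenius nonclassical if and only if there exist positive integers $n,m$ with $n\equiv m \pmod p$, and polynomials $a(t), b(t)\in\mathbb{F}_q[t]$, not divisible by $t^q-t$, such that $$f(x)=(x^q-x)^{n}a(x)^p \quad\text{and}\quad g(y)=(y^q-y)^{m}b(y)^p.$$
   Context: $p$ is a prime and $q$ is a power of $p$; $\overline{\mathbb{F}_q}$ is the algebraic closure of $\mathbb{F}_q$. For a nonconstant $F\in\mathbb{F}_q[x]$, $V_F=\{F(\alpha):\alpha\in\mathbb{F}_q\}$ is its value set; $F$ is called a minimal value set polynomial if $|V_F|=\lfloor (q-1)/\deg F\rfloor+1$. The irreducible components of a plane curve $G(x,y)=0$ are the curves $G_i=0$, where the $G_i$ are the irreducible factors of $G$ in $\overline{\mathbb{F}_q}[x,y]$; a component is defined over $\mathbb{F}_q$ if, up to a nonzero constant, $G_i\in\mathbb{F}_q[x,y]$. An (absolutely) irreducible plane curve $F(x,y)=0$ with $F\in\mathbb{F}_q[x,y]$ is called $q$-Frobenius nonclassical if $F$ divides $(x^q-x)\frac{\partial F}{\partial x}+(y^q-y)\frac{\partial F}{\partial y}$. *)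

theory Defs
  imports
    "HOL-Algebra.Algebraic_Closure_Type"
    "HOL-Number_Theory.Cong"
    "HOL-Library.Cardinality"
begin

(* Throughout, F_q is a type 'a of class finite_field, so q = CARD('a) and p = CHAR('a), and its
   algebraic closure is the type 'a alg_closure with the embedding to_ac.

   A bivariate polynomial over 'a is an element F of 'a poly poly, read as a polynomial in y (outer)
   whose coefficients are polynomials in x (inner); its value at (x, y) is poly (poly F [:y:]) x. *)

definition var_x :: "'a::comm_semiring_1 poly poly" where
  "var_x = [:[:0, 1:]:]"

definition var_y :: "'a::comm_semiring_1 poly poly" where
  "var_y = [:0, 1:]"

definition in_x :: "'a::zero poly \<Rightarrow> 'a poly poly" where
  "in_x f = [:f:]"

definition in_y :: "'a::zero poly \<Rightarrow> 'a poly poly" where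
  "in_y g = map_poly (\<lambda>c. [:c:]) g"

definition deriv_x :: "'a::idom poly poly \<Rightarrow> 'a poly poly" where
  "deriv_x F = map_poly pderiv F"

definition deriv_y :: "'a::idom poly poly \<Rightarrow> 'a poly poly" where
  "deriv_y F = pderiv F"

(* The subring k[x^r, y^r] of k[x, y]: all H(x^r, y^r) with H in k[x, y]. *)
definition polys_in_powers :: "nat \<Rightarrow> 'a::comm_semiring_1 poly poly set" where
  "polys_in_powers r =
     range (\<lambda>H. pcompose (map_poly (\<lambda>c. pcompose c (monom 1 r)) H) (monom 1 r))"

definition value_set :: "'a::comm_semiring_0 poly \<Rightarrow> 'a set" where
  "value_set F = range (poly F)"

(* On naturals, div is the floor of the quotient. *)
definition minimal_value_set_poly :: "'a::finite_field poly \<Rightarrow> bool" where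
  "minimal_value_set_poly F \<longleftrightarrow>
     degree F > 0 \<and> card (value_set F) = (CARD('a) - 1) div degree F + 1"

definition lift_ac :: "'a::field poly poly \<Rightarrow> 'a alg_closure poly poly" where
  "lift_ac F = map_poly (map_poly to_ac) F"

(* Equations of the irreducible components of the curve F = 0. Each component occurs with all the
   nonzero scalar multiples of its equation. *)
definition components :: "'a::field poly poly \<Rightarrow> 'a alg_closure poly poly set" where
  "components F = {G. irreducible G \<and> G dvd lift_ac F}"

definition equation_over_base :: "'a::field poly poly \<Rightarrow> 'a alg_closure poly poly \<Rightarrow> bool" where
  "equation_over_base H G \<longleftrightarrow> (\<exists>c. c \<noteq> 0 \<and> lift_ac H = smult [:c:] G)"

definition defined_over_base :: "'a::field alg_closure poly poly \<Rightarrow> bool" where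
  "defined_over_base G \<longleftrightarrow> (\<exists>H. equation_over_base H G)"

definition frobenius_nonclassical :: "'a::finite_field poly poly \<Rightarrow> bool" where
  "frobenius_nonclassical F \<longleftrightarrow>
     irreducible (lift_ac F) \<and>
     F dvd (var_x ^ CARD('a) - var_x) * deriv_x F + (var_y ^ CARD('a) - var_y) * deriv_y F"

(* The equation H over F_q of the component G is unique up to a nonzero factor in F_q, on which
   frobenius_nonclassical does not depend. *)
definition frobenius_nonclassical_component ::
    "'a::finite_field alg_closure poly poly \<Rightarrow> bool" where
  "frobenius_nonclassical_component G \<longleftrightarrow>
     (\<exists>H. equation_over_base H G \<and> frobenius_nonclassical H)"

end

theory Submission
  imports Defs "HOL-Number_Theory.Residues"
begin

text \<open>Write \<open>D F = (x\<^sup>q - x) F\<^sub>x + (y\<^sup>q - y) F\<^sub>y\<close>. Since \<open>D\<close> is a derivation, if all components of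
  \<open>F = f(x) - g(y)\<close> are Frobenius nonclassical then \<open>F\<close> divides \<open>D F\<close>. Evaluating the cofactor at
  points of \<open>\<F>\<^sub>q\<close>, where \<open>f\<close> and \<open>g\<close> vanish, forces \<open>(x\<^sup>q - x) f' = c f\<close> and
  \<open>(y\<^sup>q - y) g' = c g\<close> with a common constant \<open>c\<close>; splitting off the exact power of \<open>x\<^sup>q - x\<close>,
  whose derivative is \<open>-1\<close>, leaves a factor with derivative zero, that is, a \<open>p\<close>-th power.
  Conversely the given shape yields \<open>D F = - n F\<close> with \<open>n\<close> prime to \<open>p\<close>. A repeated factor of \<open>F\<close>
  would divide both \<open>f'(x)\<close> and \<open>g'(y)\<close>, which are nonzero, so \<open>F\<close> is squarefree over the algebraic
  closure and each of its factors \<open>G\<close> divides \<open>D G\<close>.\<close>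

section \<open>Coefficientwise maps and divisibility over the algebraic closure\<close>

lemma map_poly_add_hom:
  assumes "h 0 = 0" and "\<And>x y. h (x + y) = h x + h y"
  shows "map_poly h (p + q) = map_poly h p + map_poly h q"
  by (rule poly_eqI) (simp add: coeff_map_poly assms)

lemma map_poly_mult_hom:
  fixes h :: "'a::comm_semiring_1 \<Rightarrow> 'b::comm_semiring_1"
  assumes h0: "h 0 = 0" and hadd: "\<And>x y. h (x + y) = h x + h y"
    and hmult: "\<And>x y. h (x * y) = h x * h y"
  shows "map_poly h (p * q) = map_poly h p * map_poly h q"
proof (induction p)
  case (pCons a p)
  have "map_poly h (smult a q) = smult (h a) (map_poly h q)"
    by (rule map_poly_smult) (simp_all add: h0 hmult)
  then show ?case
    using pCons by (simp add: map_poly_pCons h0 map_poly_add_hom[OF h0 hadd])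
qed (simp add: h0)

text \<open>Used twice, once for each variable, this lets a linear retraction of the closure onto
  the base field act on bivariate polynomials.\<close>

lemma map_poly_retract:
  fixes h :: "'a::comm_semiring_1 \<Rightarrow> 'b::comm_semiring_1"
  assumes h0: "h 0 = 0" and r0: "r 0 = 0" and radd: "\<And>x y. r (x + y) = r x + r y"
    and rlin: "\<And>x y. r (h x * y) = x * r y"
  shows "map_poly r (map_poly h p * q) = p * map_poly r q"
proof (induction p)
  case (pCons a p)
  have "map_poly r (smult (h a) q) = smult a (map_poly r q)"
    by (rule poly_eqI) (simp add: coeff_map_poly r0 rlin)
  then show ?case
    using pCons by (simp add: map_poly_pCons h0 r0 map_poly_add_hom[OF r0 radd])
qed (simp add: r0)

lemma lift_ac_add: "lift_ac (F + G) = lift_ac F + lift_ac G"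
  by (simp add: lift_ac_def map_poly_add_hom)

lemma lift_ac_diff: "lift_ac (F - G) = lift_ac F - lift_ac G"
  by (metis add_diff_cancel_right' diff_add_cancel lift_ac_add)

lemma lift_ac_mult: "lift_ac (F * G) = lift_ac F * lift_ac G"
  unfolding lift_ac_def
  by (rule map_poly_mult_hom) (simp_all add: map_poly_add_hom map_poly_mult_hom)

lemma lift_ac_1 [simp]: "lift_ac 1 = 1"
  by (simp add: lift_ac_def)

lemma lift_ac_power: "lift_ac (F ^ n) = lift_ac F ^ n"
  by (induction n) (simp_all add: lift_ac_mult)

lemma lift_ac_in_x: "lift_ac (in_x f) = in_x (map_poly to_ac f)"
  by (simp add: lift_ac_def in_x_def map_poly_pCons)

lemma lift_ac_in_y: "lift_ac (in_y f) = in_y (map_poly to_ac f)"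
  by (rule poly_eqI) (simp add: lift_ac_def in_y_def coeff_map_poly map_poly_pCons)

lemma pderiv_map_poly_to_ac: "pderiv (map_poly to_ac f) = map_poly to_ac (pderiv f)"
  by (rule poly_eqI) (simp add: coeff_map_poly coeff_pderiv)

lemma lift_ac_deriv_x: "lift_ac (deriv_x F) = deriv_x (lift_ac F)"
  by (rule poly_eqI) (simp add: lift_ac_def deriv_x_def coeff_map_poly pderiv_map_poly_to_ac)

lemma lift_ac_deriv_y: "lift_ac (deriv_y F) = deriv_y (lift_ac F)"
  unfolding deriv_y_def lift_ac_def
  by (rule poly_eqI, rule poly_eqI) (simp add: coeff_map_poly coeff_pderiv of_nat_poly)

lemma lift_ac_var_x: "lift_ac var_x = var_x"
  by (simp add: lift_ac_def var_x_def map_poly_pCons)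

lemma lift_ac_var_y: "lift_ac var_y = var_y"
  by (simp add: lift_ac_def var_y_def map_poly_pCons)

text \<open>The retraction is the coordinate at \<open>1\<close> in a basis of the closure containing \<open>1\<close>.\<close>

lemma to_ac_linear_retraction:
  obtains r :: "'a::field alg_closure \<Rightarrow> 'a"
  where "r 0 = 0" and "\<And>x y. r (x + y) = r x + r y"
    and "\<And>c x. r (to_ac c * x) = c * r x" and "r 1 = 1"
proof -
  interpret vector_space_pair "\<lambda>(c::'a) x. to_ac c * x" "(*) :: 'a \<Rightarrow> 'a \<Rightarrow> 'a"
    by unfold_locales (simp_all add: algebra_simps)
  have ind: "vs1.independent {1}"
    by (simp add: vs1.dependent_single)
  define r where "r = construct {1} (\<lambda>_. 1)"
  interpret r: Vector_Spaces.linear "\<lambda>(c::'a) x. to_ac c * x" "(*)" r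
    unfolding r_def by (rule linear_construct[OF ind])
  show thesis
  proof (rule that[of r])
    show "r 1 = 1"
      unfolding r_def by (simp add: construct_basis[OF ind])
  qed (simp_all add: r.add r.scale)
qed

text \<open>Divisibility descends because a base-linear retraction, applied to all coefficients,
  turns a cofactor over the closure into one over the base field.\<close>

lemma lift_ac_dvd_iff: "lift_ac F dvd lift_ac G \<longleftrightarrow> F dvd G"
proof
  assume "lift_ac F dvd lift_ac G"
  then obtain Q where Q: "lift_ac G = lift_ac F * Q" ..
  obtain r :: "'a alg_closure \<Rightarrow> 'a" where r: "r 0 = 0" "\<And>x y. r (x + y) = r x + r y"
    "\<And>c x. r (to_ac c * x) = c * r x" "r 1 = 1"
    using to_ac_linear_retraction by blast
  define R where "R = map_poly (map_poly r)"
  have R: "R (lift_ac F * Q) = F * R Q" for F Q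
    unfolding R_def lift_ac_def
    by (rule map_poly_retract)
      (simp_all add: map_poly_add_hom[of r] map_poly_retract[of to_ac r] r)
  have R1: "R 1 = 1"
    by (simp add: R_def r)
  \<comment> \<open>With cofactor 1, the rule for \<open>R\<close> says that \<open>R\<close> undoes
    \<open>lift_ac\<close>.\<close>
  have "G = F * R Q"
    using R[of G 1] R[of F Q] Q R1 by simp
  then show "F dvd G" ..
next
  assume "F dvd G"
  then show "lift_ac F dvd lift_ac G"
    by (auto simp: lift_ac_mult)
qed

section \<open>The derivation \<open>D\<close>\<close>

lemma deriv_x_add: "deriv_x (F + G) = deriv_x F + deriv_x G"
  by (simp add: deriv_x_def map_poly_add_hom pderiv_add)

lemma deriv_x_mult: "deriv_x (F * G) = F * deriv_x G + G * deriv_x F"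
proof (induction F)
  case (pCons a F)
  have "deriv_x (smult a G) = smult a (deriv_x G) + smult (pderiv a) G"
    by (rule poly_eqI) (simp add: deriv_x_def coeff_map_poly pderiv_mult)
  moreover have "deriv_x (pCons b H) = pCons (pderiv b) (deriv_x H)" for b :: "'a poly" and H
    by (simp add: deriv_x_def map_poly_pCons)
  ultimately show ?case
    using pCons by (simp add: deriv_x_add)
qed (simp add: deriv_x_def)

text \<open>The exponent is a parameter because over the algebraic closure \<open>q\<close> remains
  the size of the base field.\<close>

definition frob_deriv :: "nat \<Rightarrow> 'a::idom poly poly \<Rightarrow> 'a poly poly" where
  "frob_deriv q F = (var_x ^ q - var_x) * deriv_x F + (var_y ^ q - var_y) * deriv_y F"

lemma frob_deriv_mult: "frob_deriv q (F * G) = F * frob_deriv q G + G * frob_deriv q F"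
  by (simp add: frob_deriv_def deriv_x_mult deriv_y_def pderiv_mult algebra_simps)

lemma frob_deriv_0 [simp]: "frob_deriv q 0 = 0"
  by (simp add: frob_deriv_def deriv_x_def deriv_y_def)

lemma frob_deriv_smult: "frob_deriv q (smult [:c:] G) = smult [:c:] (frob_deriv q G)"
proof -
  have "deriv_x (smult [:c:] G) = smult [:c:] (deriv_x G)"
    by (rule poly_eqI) (simp add: deriv_x_def coeff_map_poly pderiv_smult)
  then show ?thesis
    by (simp add: frob_deriv_def deriv_y_def pderiv_smult smult_add_right)
qed

lemma lift_ac_frob_deriv: "lift_ac (frob_deriv q F) = frob_deriv q (lift_ac F)"
  by (simp add: frob_deriv_def lift_ac_add lift_ac_mult lift_ac_diff lift_ac_power
      lift_ac_deriv_x lift_ac_deriv_y lift_ac_var_x lift_ac_var_y)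

lemma in_y_pCons: "in_y (pCons a v) = pCons [:a:] (in_y v)"
  by (simp add: in_y_def map_poly_pCons)

lemma in_x_mult: "in_x (f * g) = in_x f * in_x (g :: 'a::comm_semiring_1 poly)"
  by (simp add: in_x_def mult.commute)

lemma in_x_diff: "in_x (f - g) = in_x f - in_x g"
  by (simp add: in_x_def)

lemma in_x_power: "in_x (f ^ n) = in_x f ^ n"
  by (induction n) (simp_all add: in_x_mult, simp add: in_x_def one_pCons)

lemma in_y_mult: "in_y (f * g) = in_y f * in_y (g :: 'a::comm_semiring_1 poly)"
  unfolding in_y_def by (rule map_poly_mult_hom) (simp_all add: mult.commute)

lemma in_y_diff: "in_y (f - g) = in_y f - in_y (g :: 'a::ab_group_add poly)"
  by (rule poly_eqI) (simp add: in_y_def coeff_map_poly)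

lemma in_y_power: "in_y (f ^ n) = in_y (f :: 'a::comm_semiring_1 poly) ^ n"
  by (induction n) (simp_all add: in_y_mult, simp add: in_y_def one_pCons map_poly_pCons)

lemma var_x_eq: "var_x = in_x [:0, 1:]"
  by (simp add: var_x_def in_x_def)

lemma var_y_eq: "var_y = in_y [:0, 1:]"
  by (simp add: var_y_def in_y_def map_poly_pCons one_pCons)

lemma deriv_x_separated: "deriv_x (in_x f - in_y g) = in_x (pderiv f)"
  by (rule poly_eqI) (simp add: deriv_x_def in_x_def in_y_def coeff_map_poly coeff_pCons
      pderiv_diff split: nat.splits)

lemma deriv_y_separated: "deriv_y (in_x f - in_y g) = - in_y (pderiv g)"
  by (rule poly_eqI)
    (simp add: deriv_y_def in_x_def in_y_def coeff_map_poly coeff_pderiv of_nat_poly)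

lemma frob_deriv_separated:
  "frob_deriv q (in_x f - in_y g) =
     in_x (([:0, 1:] ^ q - [:0, 1:]) * pderiv f) - in_y (([:0, 1:] ^ q - [:0, 1:]) * pderiv g)"
  by (simp add: frob_deriv_def deriv_x_separated deriv_y_separated var_x_eq var_y_eq
      in_x_mult in_y_mult in_x_diff in_y_diff in_x_power in_y_power)

section \<open>Frobenius nonclassical components and factors\<close>

lemma smult_dvd_frob_deriv_iff:
  assumes "c \<noteq> 0"
  shows "smult [:c:] G dvd frob_deriv q (smult [:c:] G) \<longleftrightarrow> G dvd frob_deriv q (G :: 'a::field poly poly)"
proof -
  have *: "[:[:c:]:] * [:[:inverse c:]:] = 1"
    using assms by (simp add: one_pCons)
  have "is_unit [:[:c:]:]"
    by (metis * dvd_triv_left)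
  moreover have "smult [:c:] H = [:[:c:]:] * H" for H
    by simp
  ultimately show ?thesis
    unfolding frob_deriv_smult by (simp only: mult_unit_dvd_iff' dvd_mult_unit_iff')
qed

text \<open>A nonzero constant factor affects neither irreducibility nor the divisibility, and the
  divisibility descends from the closure, so the test can be made on \<open>G\<close>
  itself.\<close>

lemma frobenius_nonclassical_component_iff:
  fixes G :: "'a::finite_field alg_closure poly poly"
  assumes "irreducible G"
  shows "frobenius_nonclassical_component G \<longleftrightarrow>
    defined_over_base G \<and> G dvd frob_deriv CARD('a) G"
proof -
  have *: "frobenius_nonclassical H \<longleftrightarrow> G dvd frob_deriv CARD('a) G"
    if H: "equation_over_base H G" for H
  proof -
    obtain c where c: "c \<noteq> 0" "lift_ac H = smult [:c:] G"
      using H by (auto simp: equation_over_base_def)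
    have "is_unit [:[:c:]:]"
      using c(1) by (simp add: is_unit_const_poly_iff dvd_field_iff)
    then have "irreducible ([:[:c:]:] * G)"
      using assms by (simp only: irreducible_mult_unit_left)
    then have "irreducible (lift_ac H)"
      by (simp add: c(2))
    moreover have "H dvd frob_deriv CARD('a) H \<longleftrightarrow> G dvd frob_deriv CARD('a) G"
      using smult_dvd_frob_deriv_iff[OF c(1), of G "CARD('a)"]
      unfolding c(2)[symmetric] lift_ac_frob_deriv[symmetric] lift_ac_dvd_iff .
    ultimately show ?thesis
      by (simp add: frobenius_nonclassical_def frob_deriv_def)
  qed
  then show ?thesis
    by (auto simp: frobenius_nonclassical_component_def defined_over_base_def)
qed

text \<open>By the product rule \<open>D (G N) = G D N + N D G\<close>, dividing one's own image
  under \<open>D\<close> passes to products; repeated factors do no harm.\<close>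

lemma dvd_frob_deriv_of_factors:
  fixes L :: "'a::field alg_closure poly poly"
  assumes "\<And>G. irreducible G \<Longrightarrow> G dvd L \<Longrightarrow> G dvd frob_deriv q G"
  shows "L dvd frob_deriv q L"
proof -
  have "N dvd L \<longrightarrow> N dvd frob_deriv q N" for N
  proof (induction N rule: prime_divisors_induct)
    case (factor G N)
    show ?case
    proof
      assume GN: "G * N dvd L"
      have "G dvd frob_deriv q G"
        using prime_elem_imp_irreducible[OF prime_imp_prime_elem[OF factor(1)]]
          dvd_mult_left[OF GN] by (rule assms)
      moreover have "N dvd frob_deriv q N"
        using factor(2) dvd_mult_right[OF GN] ..
      ultimately show "G * N dvd frob_deriv q (G * N)"
        by (simp add: frob_deriv_mult mult.commute[of N] mult_dvd_mono)
    qed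
  next
    case (unit N)
    show ?case
      by (rule impI) (rule unit_imp_dvd[OF unit])
  qed simp
  from this[of L] show ?thesis
    by simp
qed

text \<open>With \<open>L = G M\<close> the product rule leaves \<open>G\<close> dividing
  \<open>M D G\<close>. If \<open>G\<close> divided \<open>M\<close>, it would divide both partial
  derivatives of \<open>L\<close>; so the prime \<open>G\<close> divides \<open>D G\<close>.\<close>

lemma factor_dvd_frob_deriv:
  fixes L :: "'a::field alg_closure poly poly"
  assumes G: "irreducible G" and GL: "G dvd L" and L: "L dvd frob_deriv q L"
    and nd: "\<not> (G dvd deriv_x L \<and> G dvd deriv_y L)"
  shows "G dvd frob_deriv q G"
proof -
  obtain M where M: "L = G * M"
    using GL ..
  have "G dvd G * frob_deriv q M + M * frob_deriv q G"
    using dvd_trans[OF GL L] by (simp add: M frob_deriv_mult)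
  then have "G dvd M * frob_deriv q G"
    by (simp add: dvd_add_right_iff)
  moreover have "\<not> G dvd M"
    using nd by (auto simp: M deriv_x_mult deriv_y_def pderiv_mult)
  ultimately show ?thesis
    using irreducible_imp_prime_elem[OF G] by (simp add: prime_elem_dvd_mult_iff)
qed

text \<open>The first divisibility keeps \<open>y\<close> out of \<open>G\<close>; then
  \<open>G\<close> divides every coefficient of \<open>in_y g\<close>, one of which is a nonzero
  constant.\<close>

lemma is_unit_of_dvd_in_x_in_y:
  fixes G :: "'a::field poly poly"
  assumes "G dvd in_x f" "G dvd in_y g" "f \<noteq> 0" "g \<noteq> 0"
  shows "is_unit G"
proof -
  have "degree G \<le> degree (in_x f)"
    using assms(1,3) by (intro dvd_imp_degree_le) (auto simp: in_x_def)
  then obtain u where u: "G = [:u:]"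
    by (auto simp: in_x_def elim: degree_eq_zeroE)
  obtain i where i: "coeff g i \<noteq> 0"
    using assms(4) by (auto simp: poly_eq_iff)
  have "u dvd [:coeff g i:]"
    using assms(2) by (simp add: u const_poly_dvd_iff in_y_def coeff_map_poly)
  moreover have "is_unit [:coeff g i:]"
    using i by (simp add: is_unit_const_poly_iff dvd_field_iff)
  ultimately have "is_unit u"
    using dvd_trans by blast
  then show ?thesis
    by (simp add: u is_unit_const_poly_iff)
qed

section \<open>Polynomials with zero derivative in characteristic \<open>p\<close>\<close>

lemma coeff_pcompose_monom:
  fixes u :: "'a::comm_semiring_1 poly"
  assumes "p > 0"
  shows "coeff (pcompose u (monom 1 p)) n = (if p dvd n then coeff u (n div p) else 0)"
proof (induction u arbitrary: n)
  case (pCons a u)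
  show ?case
  proof (cases "n < p")
    case True
    then show ?thesis
      using assms
      by (cases n) (auto simp: pcompose_pCons coeff_monom_mult coeff_pCons dest: dvd_imp_le)
  next
    case False
    then obtain k where k: "n = p + k"
      by (metis le_add_diff_inverse not_less)
    then show ?thesis
      using assms pCons
      by (auto simp: pcompose_pCons coeff_monom_mult coeff_pCons split: nat.splits)
  qed
qed simp

text \<open>Differentiation multiplies the coefficient at exponent \<open>n\<close> by
  \<open>n\<close>, so only exponents divisible by \<open>p\<close> can survive.\<close>

lemma pderiv_eq_0_imp_pcompose_monom:
  fixes w :: "'a::finite_field poly"
  assumes "pderiv w = 0"
  obtains u where "w = pcompose u (monom 1 CHAR('a))"
proof -
  let ?p = "CHAR('a)"
  have p: "?p > 0"
    using CHAR_pos .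
  \<comment> \<open>The bound \<open>degree w\<close> suffices: since \<open>i \<le> ?p * i\<close>,
    all later \<open>coeff w (?p * i)\<close> vanish.\<close>
  define u where "u = (\<Sum>i\<le>degree w. monom (coeff w (?p * i)) i)"
  have u: "coeff u i = coeff w (?p * i)" for i
  proof (cases "i \<le> degree w")
    case False
    moreover have "i \<le> ?p * i"
      using p by (cases ?p) simp_all
    ultimately have "degree w < ?p * i"
      by linarith
    with False show ?thesis
      by (simp add: u_def coeff_sum coeff_eq_0)
  qed (simp add: u_def coeff_sum)
  have w: "coeff w n = 0" if n: "\<not> ?p dvd n" for n
  proof -
    obtain m where m: "n = Suc m"
      using n by (cases n) auto
    have "of_nat n * coeff w n = 0"
      using arg_cong[OF assms, of "\<lambda>v. coeff v m"] by (simp add: coeff_pderiv m del: of_nat_Suc)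
    moreover have "of_nat n \<noteq> (0 :: 'a)"
      using n by (simp add: of_nat_eq_0_iff_char_dvd)
    ultimately show ?thesis
      by simp
  qed
  have "w = pcompose u (monom 1 ?p)"
    using w by (intro poly_eqI) (auto simp: coeff_pcompose_monom p u)
  then show thesis
    by (rule that)
qed

lemma pcompose_in_y: "pcompose (in_y v) (monom 1 r) = in_y (pcompose v (monom 1 r))"
proof (induction v)
  case (pCons a v)
  have "in_y (s + t) = in_y s + in_y t" for s t :: "'a poly"
    by (rule poly_eqI) (simp add: in_y_def coeff_map_poly)
  moreover have "monom 1 r = in_y (monom (1 :: 'a) r)" "[:[:a:]:] = in_y [:a:]"
    by (simp_all add: in_y_def map_poly_monom map_poly_pCons one_pCons)
  ultimately show ?case
    using pCons by (simp only: pcompose_pCons in_y_mult in_y_pCons)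
qed (simp add: in_y_def)

text \<open>Its contrapositive is how the hypothesis about \<open>F_q[x^p, y^p]\<close> enters: at
  least one derivative is nonzero.\<close>

lemma separated_in_polys_in_powers:
  fixes f g :: "'a::finite_field poly"
  assumes "pderiv f = 0" and "pderiv g = 0"
  shows "in_x f - in_y g \<in> polys_in_powers CHAR('a)"
proof -
  let ?p = "CHAR('a)"
  obtain u where u: "f = pcompose u (monom 1 ?p)"
    using pderiv_eq_0_imp_pcompose_monom[OF assms(1)] .
  obtain v where v: "g = pcompose v (monom 1 ?p)"
    using pderiv_eq_0_imp_pcompose_monom[OF assms(2)] .
  have "map_poly (\<lambda>c. pcompose c (monom 1 ?p)) (in_x u - in_y v) = in_x f - in_y v"
    by (rule poly_eqI)
      (simp add: coeff_map_poly in_x_def in_y_def coeff_pCons u pcompose_diff split: nat.splits)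
  moreover have "pcompose (in_x f - in_y v) (monom 1 ?p) = in_x f - in_y g"
    by (simp add: pcompose_diff pcompose_in_y v) (simp add: in_x_def)
  ultimately show ?thesis
    unfolding polys_in_powers_def by (intro range_eqI[of _ _ "in_x u - in_y v"]) simp
qed

text \<open>The Frobenius map is additive, so it is injective on a field and hence surjective on a
  finite one.\<close>

lemma CHAR_power_surj:
  fixes x :: "'a::finite_field"
  obtains y where "y ^ CHAR('a) = x"
proof -
  have "inj (\<lambda>y::'a. y ^ CHAR('a))"
  proof (rule injI)
    fix y z :: 'a
    assume "y ^ CHAR('a) = z ^ CHAR('a)"
    then have "(y - z) ^ CHAR('a) = 0"
      using freshmans_dream[OF CHAR_prime refl, of "y - z" z] by simp
    then show "y = z"
      by simp
  qed
  then have "surj (\<lambda>y::'a. y ^ CHAR('a))"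
    by (simp add: finite_UNIV_inj_surj)
  then show thesis
    using that by (metis surjD)
qed

text \<open>A polynomial in \<open>x^p\<close> is a \<open>p\<close>-th power because its
  coefficients are; the freshman's dream adds them one at a time.\<close>

lemma pderiv_eq_0_imp_CHAR_power:
  fixes w :: "'a::finite_field poly"
  assumes "pderiv w = 0"
  obtains a where "w = a ^ CHAR('a)"
proof -
  let ?p = "CHAR('a)"
  have p: "prime CHAR('a poly)"
    by (simp add: CHAR_prime)
  have "\<exists>a. pcompose u (monom 1 ?p) = a ^ ?p" for u :: "'a poly"
  proof (induction u)
    case 0
    then show ?case
      using CHAR_pos[where ?'a = 'a] by (intro exI[of _ 0]) simp
  next
    case (pCons c u)
    obtain a where a: "pcompose u (monom 1 ?p) = a ^ ?p"
      using pCons by blast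
    obtain d where d: "d ^ ?p = c"
      using CHAR_power_surj .
    have "([:d:] + monom 1 1 * a) ^ ?p = [:d:] ^ ?p + (monom 1 1 * a) ^ ?p"
      using freshmans_dream[OF p refl, of "[:d:]" "monom 1 1 * a"] by simp
    also have "\<dots> = [:c:] + monom 1 ?p * pcompose u (monom 1 ?p)"
      by (simp add: a d power_mult_distrib monom_power poly_const_pow)
    finally show ?case
      by (metis pcompose_pCons)
  qed
  then show thesis
    using pderiv_eq_0_imp_pcompose_monom[OF assms] that by metis
qed

section \<open>Vanishing on \<open>F_q\<close> and powers of \<open>x^q - x\<close>\<close>

lemma factor_out_power:
  fixes h f :: "'a::field poly"
  assumes "degree h > 0" and "f \<noteq> 0"
  obtains n w where "f = h ^ n * w" and "\<not> h dvd w"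
proof -
  have "\<exists>n w. f = h ^ n * w \<and> \<not> h dvd w"
    using assms(2)
  proof (induction "degree f" arbitrary: f rule: less_induct)
    case less
    show ?case
    proof (cases "h dvd f")
      case True
      then obtain k where k: "f = h * k" ..
      then have "k \<noteq> 0" "h \<noteq> 0"
        using less.prems by auto
      then have "degree k < degree f"
        using assms(1) by (simp add: k degree_mult_eq)
      then obtain n w where "k = h ^ n * w" "\<not> h dvd w"
        using less.hyps \<open>k \<noteq> 0\<close> by blast
      then show ?thesis
        by (intro exI[of _ "Suc n"] exI[of _ w]) (simp add: k mult.assoc)
    qed (intro exI[of _ 0] exI[of _ f], simp)
  qed
  then show thesis
    using that by blast
qed

lemma poly_eq_0_if_vanishes:
  fixes u :: "'a::finite_field poly"
  assumes "degree u < CARD('a)" and "\<And>x. poly u x = 0"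
  shows "u = 0"
proof (rule ccontr)
  assume "u \<noteq> 0"
  then have "card {x. poly u x = 0} \<le> degree u"
    by (rule card_poly_roots_bound)
  then show False
    using assms by simp
qed

abbreviation (input) frob_poly :: "'a::finite_field poly" where
  "frob_poly \<equiv> [:0, 1:] ^ CARD('a) - [:0, 1:]"

lemma CARD_gt_1: "CARD('a::finite_field) > 1"
  using card_mono[of UNIV "{0, 1 :: 'a}"] by simp

lemma degree_frob_poly: "degree (frob_poly :: 'a::finite_field poly) = CARD('a)"
proof -
  have "degree ([:0, 1:] ^ CARD('a) :: 'a poly) = CARD('a)"
    by (simp add: degree_power_eq)
  moreover have "degree (- [:0, 1:] :: 'a poly) = 1"
    by simp
  ultimately show ?thesis
    using CARD_gt_1[where ?'a = 'a] by (metis diff_conv_add_uminus degree_add_eq_left)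
qed

lemma frob_poly_nz: "(frob_poly :: 'a::finite_field poly) \<noteq> 0"
  using degree_frob_poly[where ?'a = 'a] CARD_gt_1[where ?'a = 'a] by force

lemma poly_frob_poly [simp]: "poly frob_poly (x :: 'a::finite_field) = 0"
  by (simp add: finite_field_power_card_eq_same)

lemma pderiv_frob_poly: "pderiv (frob_poly :: 'a::finite_field poly) = - 1"
proof -
  have "of_nat CARD('a) = (0 :: 'a)"
    using CHAR_dvd_CARD[where ?'a = 'a] by (simp add: of_nat_eq_0_iff_char_dvd)
  then show ?thesis
    by (simp add: pderiv_diff pderiv_power pderiv_pCons one_pCons)
qed

text \<open>The remainder modulo \<open>x^q - x\<close> has degree below \<open>q\<close> and still
  vanishes at all \<open>q\<close> points.\<close>

lemma frob_poly_dvd: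
  fixes f :: "'a::finite_field poly"
  assumes "\<And>x. poly f x = 0"
  shows "frob_poly dvd f"
proof -
  have "poly (f mod frob_poly) x = 0" for x
    using arg_cong[OF div_mult_mod_eq[of f frob_poly], of "\<lambda>r. poly r x"]
    by (simp only: poly_add poly_mult assms poly_frob_poly mult_zero_right add_0_left)
  moreover have "degree (f mod frob_poly) < CARD('a)"
    using degree_mod_less[OF frob_poly_nz, of f] CARD_gt_1[where ?'a = 'a]
    unfolding degree_frob_poly by (elim disjE) (simp_all only: degree_0)
  ultimately have "f mod frob_poly = 0"
    by (intro poly_eq_0_if_vanishes)
  then show ?thesis
    by (simp only: dvd_eq_mod_eq_0)
qed

text \<open>From \<open>h' = -1\<close> comes \<open>h (h^n)' = - n h^n\<close>, so
  \<open>h^n\<close> can be cancelled from an equation \<open>h f' = c f\<close>.\<close>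

lemma mult_pderiv_power_mult:
  fixes h w :: "'a::idom poly"
  assumes "pderiv h = - 1"
  shows "h * pderiv (h ^ n * w) = h ^ n * (h * pderiv w - smult (of_nat n) w)"
proof (cases n)
  case (Suc m)
  have "h * pderiv (h ^ n) = - smult (of_nat n) (h ^ n)"
    unfolding Suc pderiv_power_Suc assms by simp
  then show ?thesis
    by (simp add: pderiv_mult algebra_simps mult.left_commute[of h w])
qed simp

text \<open>Cancelling the exact power of \<open>h = x^q - x\<close> leaves
  \<open>h w' = (c + n) w\<close> with \<open>h\<close> not dividing \<open>w\<close>; this forces
  \<open>c = -n\<close> and \<open>w' = 0\<close>.\<close>

lemma frob_poly_pderiv_eq_smult:
  fixes f :: "'a::finite_field poly"
  assumes "f \<noteq> 0" and "\<And>x. poly f x = 0" and eq: "frob_poly * pderiv f = smult c f"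
  obtains n a where "n > 0" and "c = - of_nat n" and "\<not> frob_poly dvd a"
    and "f = frob_poly ^ n * a ^ CHAR('a)"
proof -
  let ?h = "frob_poly :: 'a poly"
  have "degree ?h > 0"
    using CARD_gt_1[where ?'a = 'a] by (simp only: degree_frob_poly)
  then obtain n w where f: "f = ?h ^ n * w" and w: "\<not> ?h dvd w"
    using assms(1) by (rule factor_out_power)
  \<comment> \<open>For \<open>n = 0\<close> the cofactor \<open>w\<close> would be
    \<open>f\<close>, which \<open>?h\<close> divides because \<open>f\<close> vanishes on
    \<open>F_q\<close>.\<close>
  obtain m where n: "n = Suc m"
    using w frob_poly_dvd[OF assms(2)] f by (cases n) auto
  have "?h ^ n * (?h * pderiv w - smult (of_nat n) w) = ?h ^ n * smult c w"
    using eq unfolding f mult_pderiv_power_mult[OF pderiv_frob_poly] by simp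
  then have "?h * pderiv w - smult (of_nat n) w = smult c w"
    using frob_poly_nz[where ?'a = 'a] by (simp only: mult_left_cancel power_not_zero not_False_eq_True)
  then have hw: "?h * pderiv w = smult (c + of_nat n) w"
    by (simp only: smult_add_left diff_eq_eq)
  have c: "c + of_nat n = 0"
  proof (rule ccontr)
    assume "c + of_nat n \<noteq> 0"
    then have "?h dvd w"
      using hw by (metis dvd_smult_cancel dvd_triv_left)
    with w show False ..
  qed
  then have "pderiv w = 0"
    using hw frob_poly_nz[where ?'a = 'a] by simp
  then obtain a where a: "w = a ^ CHAR('a)"
    by (rule pderiv_eq_0_imp_CHAR_power)
  moreover have "\<not> ?h dvd a"
    using w dvd_trans[OF _ dvd_power[of "CHAR('a)" a]] unfolding a by auto
  ultimately show thesis
    using that[of n a] c f n by (simp add: eq_neg_iff_add_eq_0 del: of_nat_Suc power_Suc)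
qed

text \<open>The factor \<open>a^p\<close> behaves as a constant under differentiation, so only the
  power of \<open>x^q - x\<close> contributes.\<close>

lemma frob_poly_pderiv_power:
  fixes a :: "'a::finite_field poly"
  shows "frob_poly * pderiv (frob_poly ^ n * a ^ CHAR('a)) =
    smult (- of_nat n) (frob_poly ^ n * a ^ CHAR('a))"
proof -
  have "pderiv (a ^ CHAR('a)) = 0"
    by (simp add: pderiv_power)
  then show ?thesis
    unfolding mult_pderiv_power_mult[OF pderiv_frob_poly] by simp
qed

text \<open>Substituting \<open>y = \<beta>\<close> and \<open>x = \<alpha>\<close> with \<open>\<alpha>, \<beta> \<in> \<F>\<^sub>q\<close> shows that
  the two logarithmic derivatives are polynomials of degree below \<open>q\<close> taking the same
  values \<open>M(\<alpha>, \<beta>)\<close>, hence a common constant.\<close>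

lemma separated_dvd_imp_smult:
  fixes f g :: "'a::finite_field poly"
  assumes "f \<noteq> 0" "g \<noteq> 0" and f: "\<And>x. poly f x = 0" and g: "\<And>x. poly g x = 0"
    and dvd: "in_x f - in_y g dvd in_x (frob_poly * pderiv f) - in_y (frob_poly * pderiv g)"
  obtains c where "frob_poly * pderiv f = smult c f" and "frob_poly * pderiv g = smult c g"
proof -
  \<comment> \<open>\<open>ex \<alpha>\<close> sets \<open>x = \<alpha>\<close> and keeps a
    polynomial in \<open>y\<close>; setting \<open>y = \<beta>\<close> is \<open>poly\<close> at the
    constant polynomial \<open>[:\<beta>:]\<close>.\<close>
  define ex :: "'a \<Rightarrow> 'a poly poly \<Rightarrow> 'a poly" where "ex = (\<lambda>\<alpha>. map_poly (\<lambda>c. poly c \<alpha>))"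
  obtain M where M: "in_x (frob_poly * pderiv f) - in_y (frob_poly * pderiv g) =
      (in_x f - in_y g) * M"
    using dvd ..
  have poly_in_y: "poly (in_y s) [:\<beta>:] = [:poly s \<beta>:]" for s :: "'a poly" and \<beta>
    by (induction s) (simp_all add: in_y_def map_poly_pCons)
  have ex_sep: "ex \<alpha> (in_x s - in_y t) = [:poly s \<alpha>:] - t" for \<alpha> s t
    by (rule poly_eqI)
      (simp add: ex_def in_x_def in_y_def coeff_map_poly coeff_pCons split: nat.splits)
  have ex_mult: "ex \<alpha> (s * t) = ex \<alpha> s * ex \<alpha> t" for \<alpha> s t
    unfolding ex_def by (rule map_poly_mult_hom) simp_all
  have poly_ex: "poly (ex \<alpha> s) \<beta> = poly (poly s [:\<beta>:]) \<alpha>" for \<alpha> \<beta> s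
    by (induction s) (simp_all add: ex_def map_poly_pCons)
  have fM: "frob_poly * pderiv f = f * poly M [:\<beta>:]" for \<beta>
    using arg_cong[OF M, of "\<lambda>P. poly P [:\<beta>:]"]
    by (simp add: poly_in_y g finite_field_power_card_eq_same) (simp add: in_x_def)
  have gM: "frob_poly * pderiv g = g * ex \<alpha> M" for \<alpha>
    using arg_cong[OF M, of "ex \<alpha>"]
    by (simp add: ex_mult ex_sep f finite_field_power_card_eq_same)
  define u where "u = poly M [:0:]"
  define c where "c = poly u 0"
  \<comment> \<open>The left side of \<open>fM\<close> is free of \<open>\<beta>\<close>, so
    cancelling \<open>f\<close> makes all these specialisations of \<open>M\<close> equal.\<close>
  have u: "poly M [:\<beta>:] = u" for \<beta>
    using fM[of \<beta>] fM[of 0] \<open>f \<noteq> 0\<close> unfolding u_def by (metis mult_left_cancel)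
  have v: "ex \<alpha> M = ex 0 M" for \<alpha>
    using gM[of \<alpha>] gM[of 0] \<open>g \<noteq> 0\<close> by (metis mult_left_cancel)
  have uc: "poly u \<alpha> = c" for \<alpha>
    by (metis c_def poly_ex u v)
  have vc: "poly (ex 0 M) \<beta> = c" for \<beta>
    by (simp add: poly_ex u c_def)
  \<comment> \<open>Unless \<open>w = 0\<close>, comparing degrees with
    \<open>degree (pderiv s) < degree s\<close> gives \<open>degree w < q\<close>; then
    \<open>w - [:c:]\<close> has too many roots.\<close>
  have const: "w = [:c:]"
    if w: "frob_poly * pderiv s = s * w" "s \<noteq> 0" "\<And>x. poly w x = c" for s w :: "'a poly"
  proof (cases "w = 0 \<or> pderiv s = 0")
    case True
    then have "w = 0"
      using w(1,2) by auto
    then show ?thesis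
      using w(3)[of 0] by simp
  next
    case False
    then have "degree s \<noteq> 0"
      by (metis degree_eq_zeroE pderiv_singleton)
    moreover have "degree (pderiv s) \<le> degree s - 1"
      by (rule degree_le) (simp add: coeff_pderiv coeff_eq_0)
    ultimately have "degree (pderiv s) < degree s"
      by simp
    moreover have "CARD('a) + degree (pderiv s) = degree s + degree w"
      using arg_cong[OF w(1), of degree] False w(2)
        degree_mult_eq[OF frob_poly_nz, of "pderiv s"] degree_mult_eq[of s w]
      by (simp add: degree_frob_poly)
    ultimately have "degree (w - [:c:]) < CARD('a)"
      using degree_diff_le_max[of w "[:c:]"] by simp
    then have "w - [:c:] = 0"
      by (rule poly_eq_0_if_vanishes) (simp add: w(3))
    then show ?thesis
      by simp
  qed
  have "u = [:c:]" "ex 0 M = [:c:]"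
    using const[OF fM[of 0, folded u_def] \<open>f \<noteq> 0\<close> uc] const[OF gM \<open>g \<noteq> 0\<close> vc] by simp_all
  then show thesis
    using that[of c] fM[of 0, folded u_def] gM[of 0] by simp
qed

theorem theorem4p1:
  fixes f g :: "'a::finite_field poly"
  assumes "degree f > 0" and "degree g > 0"
    and "in_x f - in_y g \<notin> polys_in_powers CHAR('a)"
    and "\<forall>G \<in> components (in_x f - in_y g). defined_over_base G"
    and "minimal_value_set_poly f" and "minimal_value_set_poly g"
    and "value_set f = {0}" and "value_set g = {0}"
  shows "(\<forall>G \<in> components (in_x f - in_y g). frobenius_nonclassical_component G) \<longleftrightarrow>
    (\<exists>(n::nat) (m::nat) (a::'a poly) (b::'a poly).
       n > 0 \<and> m > 0 \<and> [n = m] (mod CHAR('a)) \<and>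
       \<not> ([:0, 1:] ^ CARD('a) - [:0, 1:]) dvd a \<and>
       \<not> ([:0, 1:] ^ CARD('a) - [:0, 1:]) dvd b \<and>
       f = ([:0, 1:] ^ CARD('a) - [:0, 1:]) ^ n * a ^ CHAR('a) \<and>
       g = ([:0, 1:] ^ CARD('a) - [:0, 1:]) ^ m * b ^ CHAR('a))"
proof -
  let ?F = "in_x f - in_y g"
  let ?q = "CARD('a)"
  have nz: "f \<noteq> 0" "g \<noteq> 0"
    using assms(1,2) by auto
  have vanish: "poly f x = 0" "poly g x = 0" for x
    using assms(7,8) unfolding value_set_def by (metis rangeI singletonD)+
  \<comment> \<open>Since all components are defined over \<open>F_q\<close>, nonclassicality
    reduces to a divisibility over the closure.\<close>
  have comp: "(\<forall>G \<in> components ?F. frobenius_nonclassical_component G) \<longleftrightarrow>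
      (\<forall>G. irreducible G \<longrightarrow> G dvd lift_ac ?F \<longrightarrow> G dvd frob_deriv ?q G)"
  proof -
    have "frobenius_nonclassical_component G \<longleftrightarrow> G dvd frob_deriv ?q G" if "G \<in> components ?F" for G
      using that bspec[OF assms(4) that] frobenius_nonclassical_component_iff[of G]
      by (simp only: components_def mem_Collect_eq simp_thms)
    then have "(\<forall>G \<in> components ?F. frobenius_nonclassical_component G) \<longleftrightarrow>
        (\<forall>G \<in> components ?F. G dvd frob_deriv ?q G)"
      by (rule ball_cong[OF refl])
    then show ?thesis
      by (simp only: components_def Ball_def mem_Collect_eq imp_conjL)
  qed
  show ?thesis
  proof (subst comp, rule iffI)
    assume "\<forall>G. irreducible G \<longrightarrow> G dvd lift_ac ?F \<longrightarrow> G dvd frob_deriv ?q G"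
    then have "lift_ac ?F dvd frob_deriv ?q (lift_ac ?F)"
      using dvd_frob_deriv_of_factors by blast
    then have "?F dvd frob_deriv ?q ?F"
      by (simp only: lift_ac_dvd_iff lift_ac_frob_deriv[symmetric])
    then obtain c where c: "frob_poly * pderiv f = smult c f" "frob_poly * pderiv g = smult c g"
      unfolding frob_deriv_separated by (rule separated_dvd_imp_smult[OF nz vanish])
    obtain n a where n: "n > 0" "c = - of_nat n" "\<not> frob_poly dvd a"
        "f = frob_poly ^ n * a ^ CHAR('a)"
      using frob_poly_pderiv_eq_smult[OF nz(1) vanish(1) c(1)] .
    obtain m b where m: "m > 0" "c = - of_nat m" "\<not> frob_poly dvd b"
        "g = frob_poly ^ m * b ^ CHAR('a)"
      using frob_poly_pderiv_eq_smult[OF nz(2) vanish(2) c(2)] .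
    have "of_nat n = (of_nat m :: 'a)"
      using n(2) m(2) by (metis neg_equal_iff_equal)
    then have "[n = m] (mod CHAR('a))"
      by (simp only: of_nat_eq_iff_cong_CHAR)
    then show "\<exists>n m a b. n > 0 \<and> m > 0 \<and> [n = m] (mod CHAR('a)) \<and>
        \<not> frob_poly dvd a \<and> \<not> frob_poly dvd b \<and>
        f = frob_poly ^ n * a ^ CHAR('a) \<and> g = frob_poly ^ m * b ^ CHAR('a)"
      using n m by blast
  next
    assume "\<exists>n m a b. n > 0 \<and> m > 0 \<and> [n = m] (mod CHAR('a)) \<and>
        \<not> frob_poly dvd a \<and> \<not> frob_poly dvd b \<and>
        f = frob_poly ^ n * a ^ CHAR('a) \<and> g = frob_poly ^ m * b ^ CHAR('a)"
    then obtain n m a b where nm: "n > 0" "m > 0" "[n = m] (mod CHAR('a))"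
      and f: "f = frob_poly ^ n * a ^ CHAR('a)" and g: "g = frob_poly ^ m * b ^ CHAR('a)"
      by blast
    define c :: 'a where "c = - of_nat n"
    \<comment> \<open>The congruence of \<open>n\<close> and \<open>m\<close> lets one constant
      serve both \<open>f\<close> and \<open>g\<close>.\<close>
    have "c = - of_nat m"
      using nm(3) by (simp add: c_def of_nat_eq_iff_cong_CHAR)
    then have hf: "frob_poly * pderiv f = smult c f" and hg: "frob_poly * pderiv g = smult c g"
      using frob_poly_pderiv_power[of n a] frob_poly_pderiv_power[of m b]
      unfolding f[symmetric] g[symmetric] by (simp_all only: c_def)
    \<comment> \<open>Otherwise both derivatives vanish and the curve equation lies in the excluded
      subring.\<close>
    have "c \<noteq> 0"
    proof
      assume "c = 0"
      then have "pderiv f = 0" "pderiv g = 0"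
        using hf hg frob_poly_nz[where ?'a = 'a] by simp_all
      then show False
        using separated_in_polys_in_powers assms(3) by blast
    qed
    then have pderiv_nz: "pderiv f \<noteq> 0" "pderiv g \<noteq> 0"
      using hf hg nz by auto
    have "frob_deriv ?q ?F = smult [:c:] ?F"
      unfolding frob_deriv_separated hf hg
      by (rule poly_eqI) (simp add: in_x_def in_y_def coeff_map_poly coeff_pCons
          smult_diff_right split: nat.splits)
    then have "?F dvd frob_deriv ?q ?F"
      by (simp add: dvd_smult)
    then have L: "lift_ac ?F dvd frob_deriv ?q (lift_ac ?F)"
      by (simp only: lift_ac_dvd_iff lift_ac_frob_deriv[symmetric])
    show "\<forall>G. irreducible G \<longrightarrow> G dvd lift_ac ?F \<longrightarrow> G dvd frob_deriv ?q G"
    proof (intro allI impI)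
      fix G :: "'a alg_closure poly poly"
      assume G: "irreducible G" and GL: "G dvd lift_ac ?F"
      show "G dvd frob_deriv ?q G"
      proof (rule factor_dvd_frob_deriv[OF G GL L], rule notI)
        assume "G dvd deriv_x (lift_ac ?F) \<and> G dvd deriv_y (lift_ac ?F)"
        then have "G dvd in_x (map_poly to_ac (pderiv f))" "G dvd in_y (map_poly to_ac (pderiv g))"
          by (simp_all add: lift_ac_diff lift_ac_in_x lift_ac_in_y deriv_x_separated
              deriv_y_separated pderiv_map_poly_to_ac)
        then have "is_unit G"
          by (rule is_unit_of_dvd_in_x_in_y) (simp_all add: map_poly_eq_0_iff pderiv_nz)
        with G show False
          by (simp add: irreducible_def)
      qed
    qed
  qed
qed

end
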